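(* Any tie knot has a reduced tie diagram.
   Context: A nugatory crossing of a knot diagram is a crossing for which there is a topological circle in the plane meeting the diagram transversely at that crossing and nowhere else. A knot diagram is reduced if it has no nugatory crossings. Tie sequences. The tie moves are $L_i,L_o,R_i,R_o,C_i,C_o$; the letter names a region (left, right, center) and the subscript a direction ($i$ = in, $o$ = out). A tie sequence is a finite list of tie moves followed by the symbol $T$ (tuck) such that: it begins with $L_i$ or $L_o$; no two consecutive moves have the same letter; directions alternate between in and out; it ends with $L_oR_iC_oT$ or $R_oL_iC_oT$. There is no bound on the number of moves. Tie diagrams. In the plane, the passive strand starts at a point $b$ at the bottom, runs up the "straight strand" to a point $x$, then up the left side of the "neck loop", clockwise over its top, and down its right side to a point $a$ just to the right of $x$. The active strand starts at $a$; its first move (an $L$ move) carries it leftward across the passive strand at $x$, closing the neck loop (the first crossing, counted as the topmost crossing of the straight strand). $C$ is the region inside the neck loop; $L$ and $R$ are the regions outside it to the left and right of the straight strand (the active strand never passes above the neck loop). Each further move carries the active strand from its current region to the named region, crossing the passive strand exactly once: across the straight strand between $L$ and $R$, across the left side of the neck loop between $L$ and $C$, across the right side between $R$ and $C$. An in-move means the active strand crosses over, an out-move that it crosses under. Successive crossings on the straight strand are placed lower and lower, and successive crossings on each side of the neck loop are placed higher and higher (farther from the first crossing), so that these moves create no self-crossing of the active strand. Tuck: if the sequence ends with $R_oL_iC_oT$, let $\ell$ be the arc of the active strand in region $R$ between the crossings of the final $R_o$ and final $L_i$. After $C_o$ the active strand leaves $C$ passing over the right side of the neck loop, above all earlier crossings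 there (crossing $t_1$, an $R_i$ move), then crosses $\ell$ over (crossing $t_2$) and then under (crossing $t_3$), where $t_2$ precedes $t_3$ along $\ell$ from $R_o$ to $L_i$, and then runs to $b$ with no further crossings. If the sequence ends with $L_oR_iC_oT$, interchange $L$ and $R$ in this description (so $t_1$ is an $L_i$ move). The resulting closed curve with crossing information is the tie diagram of the sequence. A tie knot is a knot in $\mathbb{R}^3$ equivalent (ambient isotopic) to the one given by the tie diagram of some tie sequence. The term tie diagram is also used for shortened lists of moves: a list of moves without $T$ that begins with an $L$ move, ends with an $L$ or $R$ move, has no two consecutive moves with the same letter, and has alternating directions also has a tie diagram, drawn by the same rules, where after the last move the active strand runs to $b$ with no further crossings; and the empty list $\emptyset$ has as its tie diagram the crossingless round circle, representing the unknot. A tie knot has a given tie diagram if that diagram represents a knot equivalent to it. *)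

theory Defs
  imports "HOL-Analysis.Analysis" "HOL-Library.Sublist"
begin

section \<open>Knots and ambient isotopy\<close>

definition knot :: "(real^3) set \<Rightarrow> bool" where
  "knot K \<longleftrightarrow> (\<exists>g. simple_path g \<and> pathfinish g = pathstart g \<and> path_image g = K)"

definition ambient_isotopic :: "(real^3) set \<Rightarrow> (real^3) set \<Rightarrow> bool" where
  "ambient_isotopic K K' \<longleftrightarrow>
     (\<exists>H :: real \<times> (real^3) \<Rightarrow> real^3.
        continuous_on ({0..1} \<times> UNIV) H \<and>
        (\<forall>t\<in>{0..1}. \<exists>g. homeomorphism UNIV UNIV (\<lambda>x. H (t, x)) g) \<and>
        (\<forall>x. H (0, x) = x) \<and>
        (\<lambda>x. H (1, x)) ` K = K')"


section \<open>Knot diagrams\<close>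

text \<open>
  A diagram is a closed plane curve, parametrised by the unit interval, with crossing
  information: if the parameters \<open>s\<close> and \<open>t\<close> meet at a crossing, \<open>over D s t\<close> says that the
  strand through \<open>s\<close> passes over the strand through \<open>t\<close>. The relation \<open>over D\<close> carries no
  meaning away from crossings.
\<close>

record knot_diagram =
  curve :: "real \<Rightarrow> complex"
  over :: "real \<Rightarrow> real \<Rightarrow> bool"

definition crossing :: "knot_diagram \<Rightarrow> real \<Rightarrow> real \<Rightarrow> bool" where
  "crossing D s t \<longleftrightarrow>
     s \<in> {0..<1} \<and> t \<in> {0..<1} \<and> s \<noteq> t \<and> curve D s = curve D t"

definition plane_proj :: "real^3 \<Rightarrow> complex" where
  "plane_proj p = Complex (p $ 1) (p $ 2)"

definition diagram_of :: "(real \<Rightarrow> real^3) \<Rightarrow> knot_diagram" where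
  "diagram_of g = \<lparr> curve = plane_proj \<circ> g, over = (\<lambda>s t. g s $ 3 > g t $ 3) \<rparr>"

definition represents :: "knot_diagram \<Rightarrow> (real^3) set \<Rightarrow> bool" where
  "represents D K \<longleftrightarrow>
     (\<exists>g. path g \<and> pathfinish g = pathstart g \<and>
          (\<forall>t\<in>{0..1}. plane_proj (g t) = curve D t) \<and>
          (\<forall>s t. crossing D s t \<and> over D s t \<longrightarrow> g s $ 3 > g t $ 3) \<and>
          ambient_isotopic (path_image g) K)"

text \<open>
  The circle \<open>c\<close> is only a topological one, so transversality is topological: passing the
  parameter \<open>s\<close>, the curve changes from one side of \<open>c\<close> to the other. The fractional part
  makes this meaningful at the base point of the closed curve as well. At a crossing where
  \<open>c\<close> meets the diagram nowhere else, both strands change sides exactly if \<open>c\<close> runs through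
  two opposite quadrants.
\<close>

definition passes_through :: "(real \<Rightarrow> complex) \<Rightarrow> real \<Rightarrow> complex set \<Rightarrow> bool" where
  "passes_through \<gamma> s c \<longleftrightarrow>
     (\<forall>\<^sub>F u in at_right 0. \<gamma> (frac (s - u)) \<in> inside c \<and> \<gamma> (frac (s + u)) \<in> outside c) \<or>
     (\<forall>\<^sub>F u in at_right 0. \<gamma> (frac (s - u)) \<in> outside c \<and> \<gamma> (frac (s + u)) \<in> inside c)"

definition nugatory :: "knot_diagram \<Rightarrow> real \<Rightarrow> real \<Rightarrow> bool" where
  "nugatory D s t \<longleftrightarrow> crossing D s t \<and>
     (\<exists>c. simple_path c \<and> pathfinish c = pathstart c \<and>
          path_image c \<inter> path_image (curve D) = {curve D s} \<and>
          passes_through (curve D) s (path_image c) \<and>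
          passes_through (curve D) t (path_image c))"

definition reduced_diagram :: "knot_diagram \<Rightarrow> bool" where
  "reduced_diagram D \<longleftrightarrow> (\<forall>s t. \<not> nugatory D s t)"


section \<open>Tie sequences\<close>

datatype region = Lft | Rgt | Ctr
datatype direction = In | Out

type_synonym move = "region \<times> direction"

text \<open>\<open>Tucked ms\<close> is the list \<open>ms\<close> followed by the tuck symbol, \<open>Untucked ms\<close> is \<open>ms\<close> alone.\<close>

datatype tie_list = Tucked "move list" | Untucked "move list"

definition alternating :: "move list \<Rightarrow> bool" where
  "alternating ms \<longleftrightarrow> successively (\<lambda>m m'. fst m \<noteq> fst m' \<and> snd m \<noteq> snd m') ms"

fun tie_sequence :: "tie_list \<Rightarrow> bool" where
  "tie_sequence (Tucked ms) \<longleftrightarrow>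
     ms \<noteq> [] \<and> fst (hd ms) = Lft \<and> alternating ms \<and>
     (suffix [(Lft, Out), (Rgt, In), (Ctr, Out)] ms \<or>
      suffix [(Rgt, Out), (Lft, In), (Ctr, Out)] ms)"
| "tie_sequence (Untucked ms) \<longleftrightarrow> False"

fun shortened_list :: "tie_list \<Rightarrow> bool" where
  "shortened_list (Tucked ms) \<longleftrightarrow> False"
| "shortened_list (Untucked ms) \<longleftrightarrow>
     ms = [] \<or> fst (hd ms) = Lft \<and> fst (last ms) \<in> {Lft, Rgt} \<and> alternating ms"


section \<open>Tie diagrams\<close>

text \<open>
  Tie diagrams are drawn as polygons, all edges of which are horizontal or vertical. The third
  coordinate records the crossing information: the passive strand has height 0, and the edge of
  the active strand that makes a move lies above 0 for an in-move and below 0 for an out-move.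
  Moves are numbered from 0, and \<open>n\<close> is their number, not counting the tuck.

  The straight strand is the line \<open>x = 0\<close> from the bottom point \<open>(0, -n)\<close> to \<open>(0, 1)\<close>;
  the first crossing is \<open>(0, 0)\<close>. The sides of the neck loop are the lines \<open>x = -1\<close>, \<open>x = 1\<close>,
  and its top is the line \<open>y = n + 2\<close>. The active strand starts at \<open>(1, 0)\<close>.
\<close>

fun polygonal_path :: "'a::real_normed_vector list \<Rightarrow> real \<Rightarrow> 'a" where
  "polygonal_path [] = (\<lambda>t. 0)"
| "polygonal_path [p] = linepath p p"
| "polygonal_path [p, q] = linepath p q"
| "polygonal_path (p # q # r # ps) = linepath p q +++ polygonal_path (q # r # ps)"

abbreviation pt :: "real \<Rightarrow> real \<Rightarrow> real \<Rightarrow> real^3" where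
  "pt x y z \<equiv> vector [x, y, z]"

definition passive_strand :: "nat \<Rightarrow> (real^3) list" where
  "passive_strand n =
     [pt 0 (- real n) 0, pt 0 1 0, pt (-1) 1 0, pt (-1) (real n + 2) 0, pt 1 (real n + 2) 0, pt 1 0 0]"

fun side :: "region \<Rightarrow> real" where
  "side Lft = -1"
| "side Rgt = 1"
| "side Ctr = 0"

fun height :: "direction \<Rightarrow> real" where
  "height In = 1"
| "height Out = -1"

text \<open>
  Move number \<open>j\<close> is made by a horizontal edge with second coordinate \<open>level ms j\<close>, which
  crosses the straight strand (ever lower) or a side of the neck loop (ever higher). Between
  the moves \<open>j\<close> and \<open>j + 1\<close> the active strand runs vertically along \<open>x = column ms j\<close>, within
  the region named by the move \<open>j\<close>; in the outer regions these columns move ever farther out.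
\<close>

definition level :: "move list \<Rightarrow> nat \<Rightarrow> real" where
  "level ms j =
     (if j > 0 \<and> (fst (ms ! (j - 1)) = Ctr \<or> fst (ms ! j) = Ctr) then real j + 1 else - real j)"

definition column :: "move list \<Rightarrow> nat \<Rightarrow> real" where
  "column ms j = side (fst (ms ! j)) * (real j + 2)"

definition active_strand :: "move list \<Rightarrow> (real^3) list" where
  "active_strand ms =
     pt (column ms 0) (level ms 0) (height (snd (ms ! 0))) #
     concat (map (\<lambda>j. [pt (column ms (j - 1)) (level ms j) (height (snd (ms ! j))),
                       pt (column ms j) (level ms j) (height (snd (ms ! j)))])
                 [1..<length ms])"

text \<open>
  Let \<open>r\<close> be the region of the third move from the end. The arc \<open>l\<close> to be crossed in the tuck
  is the column of that move, at \<open>x = side r * (n - 1)\<close>, which ends at \<open>y = 2 - n\<close> and begins at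
  \<open>y = 3 - n\<close> or higher up, with heights increasing from -1 to 1 along it. The first tuck crossing
  is an ordinary in-move to \<open>r\<close>. The horizontal edges at \<open>8/3 - n\<close> and \<open>7/3 - n\<close> then cross \<open>l\<close>,
  the former at height 1 and the latter, which comes later along \<open>l\<close>, at height -1.
\<close>

fun tie_polygon :: "tie_list \<Rightarrow> (real^3) list" where
  "tie_polygon (Tucked ms) =
     (let n = real (length ms); r = fst (ms ! (length ms - 3)) in
        passive_strand (length ms) @ active_strand (ms @ [(r, In)]) @
        [pt (side r * (n + 2)) (8/3 - n) 1,
         pt (side r * (n - 3/2)) (8/3 - n) 1,
         pt (side r * (n - 3/2)) (7/3 - n) (-1),
         pt (side r * (n + 2)) (7/3 - n) (-1),
         pt (side r * (n + 2)) (- n) 0,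
         pt 0 (- n) 0])"
| "tie_polygon (Untucked ms) =
     (let n = real (length ms) in
        passive_strand (length ms) @ active_strand ms @
        [pt (column ms (length ms - 1)) (- n) 0,
         pt 0 (- n) 0])"

definition tie_diagram :: "tie_list \<Rightarrow> knot_diagram" where
  "tie_diagram w =
     diagram_of (if w = Untucked [] then (\<lambda>t. pt (cos (2 * pi * t)) (sin (2 * pi * t)) 0)
                 else polygonal_path (tie_polygon w))"

definition tie_knot :: "(real^3) set \<Rightarrow> bool" where
  "tie_knot K \<longleftrightarrow> knot K \<and> (\<exists>w. tie_sequence w \<and> represents (tie_diagram w) K)"

definition has_tie_diagram :: "(real^3) set \<Rightarrow> tie_list \<Rightarrow> bool" where
  "has_tie_diagram K w \<longleftrightarrow>
     (tie_sequence w \<or> shortened_list w) \<and> represents (tie_diagram w) K"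

end

theory Submission
  imports Defs
begin

text \<open>The diagram of every tie sequence is already reduced. A circle witnessing a nugatory crossing
  at \<open>p\<close> has points of the curve on both of its sides, but meets the curve only in \<open>p\<close>, so that
  \<open>p\<close> is a cut point of the curve. The curve of a tucked list has no cut points, by an ear
  decomposition: start with the neck loop closed up by the first crossing; attach the arc that runs
  from the last move along the active strand back to the last crossing of the straight strand and
  from there up to the first crossing; then attach the arcs of the active strand between successive
  moves, and finally the three arcs into which the first tuck crossing and the two crossings with \<open>l\<close>
  cut the rest. Attaching an arc with distinct end points creates no cut points, no matter how the arc
  meets the set in between.\<close>

section \<open>Sets without cut points\<close>

definition no_cut_point :: "'a::topological_space set \<Rightarrow> bool" where
  "no_cut_point A \<longleftrightarrow> (\<forall>p. connected (A - {p}))"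

lemma no_cut_pointD: "no_cut_point A \<Longrightarrow> connected (A - {p})"
  by (simp add: no_cut_point_def)

lemma reduced_diagram_if_no_cut_point:
  assumes "no_cut_point (path_image (curve D))"
  shows "reduced_diagram D"
  unfolding reduced_diagram_def
proof (intro allI notI)
  fix s t
  assume "nugatory D s t"
  then obtain c where c: "simple_path c"
      "path_image c \<inter> path_image (curve D) = {curve D s}"
      "passes_through (curve D) s (path_image c)"
    unfolding nugatory_def by blast
  let ?S = "path_image (curve D)" and ?c = "path_image c"
  have in_S: "curve D (frac x) \<in> ?S" for x
    by (auto simp: path_image_def frac_lt_1 less_imp_le)
  let ?in = "\<lambda>r. curve D (frac r) \<in> inside ?c" and ?out = "\<lambda>r. curve D (frac r) \<in> outside ?c"
  \<comment> \<open>Since \<open>at_right 0\<close> is a nontrivial filter, what holds eventually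
    holds for some \<open>u\<close>. It gives points of the curve on both sides of the
    circle.\<close>
  from c(3) obtain u where "?in (s - u) \<and> ?out (s + u) \<or> ?out (s - u) \<and> ?in (s + u)"
    unfolding passes_through_def
    by (auto dest!: eventually_happens)
  then obtain x y where xy: "x \<in> ?S" "y \<in> ?S" "x \<in> inside ?c" "y \<in> outside ?c"
    using in_S by blast
  have cl: "closed ?c" using c(1) closed_simple_path_image by blast
  have "connected (?S - {curve D s})" using assms by (rule no_cut_pointD)
  moreover have "?S - {curve D s} \<subseteq> inside ?c \<union> outside ?c"
    using c(2) inside_Un_outside[of ?c] by blast
  moreover have "x \<in> inside ?c \<inter> (?S - {curve D s})" "y \<in> outside ?c \<inter> (?S - {curve D s})"
    using xy c(2) inside_no_overlap[of ?c] outside_no_overlap[of ?c] by blast+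
  moreover have "inside ?c \<inter> outside ?c = {}" by (rule inside_Int_outside)
  ultimately show False
    using connectedD[of "?S - {curve D s}" "inside ?c" "outside ?c"] open_inside[OF cl] open_outside[OF cl]
    by blast
qed

text \<open>A removed point of the loop can be made its base point by shifting the parametrisation;
  what remains is the image of the open interval.\<close>

lemma no_cut_point_simple_loop:
  assumes "simple_path c" "pathfinish c = pathstart c"
  shows "no_cut_point (path_image c)"
  unfolding no_cut_point_def
proof
  fix p
  show "connected (path_image c - {p})"
  proof (cases "p \<in> path_image c")
    case True
    then obtain a where a: "a \<in> {0..1}" "p = c a" by (auto simp: path_image_def)
    have "connected (path_image (shiftpath a c)
        - {pathstart (shiftpath a c), pathfinish (shiftpath a c)})"
      using assms a by (intro connected_simple_path_endless simple_path_shiftpath) auto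
    then show ?thesis
      using assms a by (simp add: path_image_shiftpath pathstart_shiftpath pathfinish_shiftpath)
  next
    case False
    then show ?thesis using assms by (simp add: connected_simple_path_image)
  qed
qed

text \<open>A point \<open>p\<close> of the arc cuts it into at most two nonempty pieces. By
  injectivity each of them contains an end point of the arc other than \<open>p\<close>, and this
  point attaches it to \<open>A - {p}\<close>.\<close>

lemma no_cut_point_Un_arc:
  fixes g :: "real \<Rightarrow> 'a::real_normed_vector"
  assumes A: "no_cut_point A" and g: "arc g" "pathstart g \<in> A" "pathfinish g \<in> A"
  shows "no_cut_point (A \<union> path_image g)"
  unfolding no_cut_point_def
proof
  fix p
  have cA: "connected (A - {p})" using A by (rule no_cut_pointD)
  have inj: "inj_on g {0..1}" and cont: "continuous_on {0..1} g"
    using g by (auto simp: arc_def path_def)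
  have ends: "g 0 \<in> A" "g 1 \<in> A" using g by (auto simp: pathstart_def pathfinish_def)
  show "connected (A \<union> path_image g - {p})"
  proof (cases "p \<in> path_image g")
    case False
    have ne: "pathstart g \<noteq> p" using False pathstart_in_path_image by blast
    have "connected ((A - {p}) \<union> path_image g)"
      using cA connected_arc_image[OF g(1)] g(2) ne pathstart_in_path_image
      by (intro connected_Un) auto
    moreover have "(A - {p}) \<union> path_image g = A \<union> path_image g - {p}" using False by auto
    ultimately show ?thesis by simp
  next
    case True
    then obtain s where s: "s \<in> {0..1}" "p = g s" by (auto simp: path_image_def)
    have img: "path_image g - {p} = g ` {0..<s} \<union> g ` {s<..1}" (is "_ = ?B \<union> ?C")
    proof
      show "path_image g - {p} \<subseteq> ?B \<union> ?C"
      proof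
        fix z
        assume "z \<in> path_image g - {p}"
        then obtain u where "u \<in> {0..1}" "z = g u" "z \<noteq> p" by (auto simp: path_image_def)
        then show "z \<in> ?B \<union> ?C" using s by (cases u s rule: linorder_cases) auto
      qed
      show "?B \<union> ?C \<subseteq> path_image g - {p}"
        using s inj by (force simp: path_image_def inj_on_def)
    qed
    have B: "connected ((A - {p}) \<union> ?B)"
    \<comment> \<open>For \<open>s = 0\<close> the piece \<open>?B\<close> is empty, just as
      \<open>?C\<close> is for \<open>s = 1\<close>.\<close>
    proof (cases "s = 0")
      case False
      have "connected ?B"
        using s by (intro connected_continuous_image continuous_on_subset[OF cont]) auto
      moreover have "g 0 \<in> (A - {p}) \<inter> ?B"
        using s False ends inj by (force simp: inj_on_def)
      ultimately show ?thesis using cA by (intro connected_Un) auto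
    qed (simp add: cA)
    have "connected (((A - {p}) \<union> ?B) \<union> ?C)"
    proof (cases "s = 1")
      case False
      have "connected ?C"
        using s by (intro connected_continuous_image continuous_on_subset[OF cont]) auto
      moreover have "g 1 \<in> (A - {p}) \<inter> ?C"
        using s False ends inj by (force simp: inj_on_def)
      ultimately show ?thesis by (intro connected_Un[OF B]) auto
    qed (use B in simp)
    moreover have "A \<union> path_image g - {p} = ((A - {p}) \<union> ?B) \<union> ?C" using img by auto
    ultimately show ?thesis by simp
  qed
qed


section \<open>Polygonal lines\<close>

text \<open>The trace of a polygonal path as a mere point set, so that the curve can be cut and
  regrouped without regard to parametrisations.\<close>

fun polyline :: "'a::real_vector list \<Rightarrow> 'a set" where
  "polyline [] = {}"
| "polyline [p] = {p}"
| "polyline (p # q # ps) = closed_segment p q \<union> polyline (q # ps)"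

lemma polyline_append_Cons: "polyline (xs @ p # ys) = polyline (xs @ [p]) \<union> polyline (p # ys)"
proof (induction xs rule: polyline.induct)
  case 1
  then show ?case by (cases ys) auto
next
  case (2 q)
  then show ?case by (cases ys) auto
qed auto

lemma linear_image_polyline: "linear f \<Longrightarrow> f ` polyline ps = polyline (map f ps)"
  by (induction ps rule: polyline.induct) (auto simp: closed_segment_linear_image image_Un)

lemma pathstart_polygonal_path [simp]: "pathstart (polygonal_path (p # ps)) = p"
  by (induction "p # ps" rule: polygonal_path.induct) auto

lemma pathfinish_polygonal_path [simp]: "ps \<noteq> [] \<Longrightarrow> pathfinish (polygonal_path ps) = last ps"
  by (induction ps rule: polygonal_path.induct) auto

lemma path_image_polygonal_path: "ps \<noteq> [] \<Longrightarrow> path_image (polygonal_path ps) = polyline ps"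
proof (induction ps rule: polygonal_path.induct)
  case (3 p q)
  then show ?case by auto
qed (auto simp: path_image_join)

text \<open>Used as an introduction rule, this reduces injectivity of a polygonal path to
  intersections of each edge with the later ones.\<close>

lemma arc_polygonal_path_Cons:
  assumes "p \<noteq> q" "arc (polygonal_path (q # r # ps))"
    and "closed_segment p q \<inter> polyline (q # r # ps) \<subseteq> {q}"
  shows "arc (polygonal_path (p # q # r # ps))"
  using assms by (auto simp: path_image_polygonal_path simp del: polyline.simps intro!: arc_join)

lemma no_cut_point_Un_polyline:
  assumes "no_cut_point A" "arc (polygonal_path ps)" "ps \<noteq> []" "hd ps \<in> A" "last ps \<in> A"
  shows "no_cut_point (A \<union> polyline ps)"
proof -
  have "pathstart (polygonal_path ps) = hd ps" using assms(3) by (cases ps) auto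
  then show ?thesis
    using no_cut_point_Un_arc[OF assms(1,2)] assms by (simp add: path_image_polygonal_path)
qed

lemma no_cut_point_polyline_loop:
  assumes "arc (polygonal_path ps)" "arc (polygonal_path qs)" "ps \<noteq> []" "qs \<noteq> []"
    and "hd qs = last ps" "last qs = hd ps" "polyline ps \<inter> polyline qs \<subseteq> {hd ps, last ps}"
  shows "no_cut_point (polyline ps \<union> polyline qs)"
proof -
  let ?g = "polygonal_path ps" and ?h = "polygonal_path qs"
  have st: "pathstart ?g = hd ps" "pathstart ?h = hd qs" using assms(3,4) by (cases ps; cases qs; auto)+
  have "no_cut_point (path_image (?g +++ ?h))"
    using assms st by (intro no_cut_point_simple_loop simple_path_join_loop)
      (auto simp: path_image_polygonal_path)
  then show ?thesis using assms st by (simp add: path_image_join path_image_polygonal_path)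
qed

section \<open>Ears with horizontal and vertical edges\<close>

lemma horizontal_segment:
  "closed_segment (Complex a y) (Complex b y) = {z. Im z = y \<and> Re z \<in> closed_segment a b}"
  by (simp add: closed_segment_same_Im)

lemma vertical_segment:
  "closed_segment (Complex x a) (Complex x b) = {z. Re z = x \<and> Im z \<in> closed_segment a b}"
  by (simp add: closed_segment_same_Re)

lemmas axis_segments = horizontal_segment vertical_segment

text \<open>The two horizontal edges have different heights and meet the vertical one only at its
  ends, so the line is an arc whatever the order of \<open>a\<close>, \<open>b\<close> and
  \<open>c\<close>.\<close>

lemma no_cut_point_HVH:
  assumes "no_cut_point A" "Complex a y \<in> A" "Complex b y' \<in> A" "a \<noteq> c" "b \<noteq> c" "y \<noteq> y'"
  shows "no_cut_point (A \<union> polyline [Complex a y, Complex c y, Complex c y', Complex b y'])"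
  using assms
  by (intro no_cut_point_Un_polyline arc_polygonal_path_Cons)
    (auto simp: axis_segments complex_eq_iff)

text \<open>The last hypothesis keeps the first horizontal edge away from the second one and from
  the final vertical edge.\<close>

lemma no_cut_point_HVHV:
  assumes "no_cut_point A" "Complex a y \<in> A" "Complex b y'' \<in> A" "a \<noteq> c" "b \<noteq> c" "y' \<noteq> y''"
    and "y \<notin> closed_segment y' y''"
  shows "no_cut_point
    (A \<union> polyline [Complex a y, Complex c y, Complex c y', Complex b y', Complex b y''])"
  using assms
  by (intro no_cut_point_Un_polyline arc_polygonal_path_Cons)
    (auto simp: axis_segments complex_eq_iff)

text \<open>This is the neck loop, closed by the piece of the first active edge from
  \<open>(1, 0)\<close> to the crossing at the origin.\<close>

lemma no_cut_point_neck:
  fixes h :: real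
  assumes "h > 1"
  shows "no_cut_point
    (polyline [Complex 0 0, Complex 0 1, Complex (-1) 1, Complex (-1) h] \<union>
     polyline [Complex (-1) h, Complex 1 h, Complex 1 0, Complex 0 0])"
  using assms
  by (intro no_cut_point_polyline_loop arc_polygonal_path_Cons)
    (auto simp: axis_segments complex_eq_iff closed_segment_eq_real_ivl)

section \<open>The curve of a tucked list\<close>

text \<open>Crossings lie inside edges of the tie polygon; this makes them vertices, at which the
  curve can be cut into ears.\<close>

lemma polyline_insert:
  fixes p q r :: "'a::euclidean_space"
  assumes "q \<in> closed_segment p r"
  shows "polyline (xs @ p # r # ys) = polyline (xs @ p # q # r # ys)"
  using Un_closed_segment[OF assms, symmetric]
    polyline_append_Cons[of xs p "r # ys"] polyline_append_Cons[of xs p "q # r # ys"]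
  by (simp add: Un_assoc)

text \<open>Only the ends of the columns are listed. The horizontal edge of the move
  \<open>Suc j\<close> arises as the link from column \<open>j\<close> to column
  \<open>Suc j\<close>.\<close>

definition stair :: "(nat \<Rightarrow> real) \<Rightarrow> (nat \<Rightarrow> real) \<Rightarrow> nat \<Rightarrow> complex list" where
  "stair c l k = concat (map (\<lambda>j. [Complex (c j) (l j), Complex (c j) (l (Suc j))]) [0..<k])"

lemma stair_0 [simp]: "stair c l 0 = []"
  by (simp add: stair_def)

lemma stair_Suc:
  "stair c l (Suc k) = stair c l k @ [Complex (c k) (l k), Complex (c k) (l (Suc k))]"
  by (simp add: stair_def)

text \<open>The part of the active strand between the crossings of the moves \<open>j\<close> and \<open>j + 1\<close>; these
  crossings are at \<open>x = x j\<close> and \<open>x = x (j + 1)\<close>.\<close>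

definition stair_arc ::
    "(nat \<Rightarrow> real) \<Rightarrow> (nat \<Rightarrow> real) \<Rightarrow> (nat \<Rightarrow> real) \<Rightarrow> nat \<Rightarrow> complex set" where
  "stair_arc x c l j = polyline [Complex (x j) (l j), Complex (c j) (l j),
     Complex (c j) (l (Suc j)), Complex (x (Suc j)) (l (Suc j))]"

text \<open>Each crossing is inserted as a vertex into its horizontal edge. The singleton accounts
  for \<open>k = 0\<close>.\<close>

lemma polyline_stair:
  assumes "\<And>j. j < k \<Longrightarrow> x (Suc j) \<in> closed_segment (c j) (c (Suc j))"
  shows "polyline (Complex (x 0) (l 0) # stair c l k @ [Complex (x k) (l k)]) =
    {Complex (x 0) (l 0)} \<union> (\<Union>j<k. stair_arc x c l j)"
  using assms
proof (induction k)
  case (Suc k)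
  let ?x = "\<lambda>j. Complex (x j) (l j)"
  let ?ys = "[Complex (c k) (l (Suc k)), ?x (Suc k)]"
  have "polyline (?x 0 # stair c l k @ Complex (c k) (l k) # ?ys) =
      polyline (?x 0 # stair c l k @ ?x k # Complex (c k) (l k) # ?ys)"
  \<comment> \<open>For \<open>k = 0\<close> the inserted point just repeats the starting vertex;
    otherwise it lies on the edge coming from the previous column.\<close>
  proof (cases k)
    case (Suc i)
    have "?x k \<in> closed_segment (Complex (c i) (l k)) (Complex (c k) (l k))"
      using Suc.prems[of i] Suc by (simp add: horizontal_segment)
    from polyline_insert[OF this, of "?x 0 # stair c l i @ [Complex (c i) (l i)]" ?ys]
    show ?thesis using Suc by (simp add: stair_Suc)
  qed auto
  then have "polyline (?x 0 # stair c l (Suc k) @ [?x (Suc k)]) =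
      polyline ((?x 0 # stair c l k) @ ?x k # Complex (c k) (l k) # ?ys)"
    by (simp add: stair_Suc)
  also have "\<dots> = polyline (?x 0 # stair c l k @ [?x k]) \<union> stair_arc x c l k"
    by (subst polyline_append_Cons) (simp add: stair_arc_def)
  finally show ?case using Suc by (auto simp: lessThan_Suc)
qed auto

text \<open>With all crossings already in \<open>A\<close>, every stair arc is an ear of shape
  HVH.\<close>

lemma no_cut_point_Un_stair_arcs:
  assumes "no_cut_point A"
    and "\<And>j. j \<le> k \<Longrightarrow> Complex (x j) (l j) \<in> A"
    and "\<And>j. j < k \<Longrightarrow> x j \<noteq> c j \<and> x (Suc j) \<noteq> c j \<and> l j \<noteq> l (Suc j)"
  shows "no_cut_point (A \<union> (\<Union>j<k. stair_arc x c l j))"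
  using assms
proof (induction k)
  case (Suc k)
  let ?B = "A \<union> (\<Union>j<k. stair_arc x c l j)"
  have "no_cut_point (?B \<union> stair_arc x c l k)"
    unfolding stair_arc_def[of _ _ _ k] using Suc by (intro no_cut_point_HVH) auto
  then show ?case by (simp add: lessThan_Suc Un_ac)
qed auto

text \<open>The geometry is reduced to numerical facts: \<open>N\<close> is the number of moves,
  \<open>m\<close> the index of the third move from the end, \<open>s\<close> the side of its
  region. Index \<open>m + 3\<close> stands for the first tuck crossing, treated as one more
  move.\<close>

lemma no_cut_point_tucked_curve:
  fixes x c l :: "nat \<Rightarrow> real" and s :: real and m :: nat
  defines "N \<equiv> real (m + 3)"
  assumes s: "s = 1 \<or> s = -1"
    and first: "x 0 = 0" "l 0 = 0" "c 0 < 0"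
    and between: "\<And>j. j < m + 3 \<Longrightarrow> x (Suc j) \<in> closed_segment (c j) (c (Suc j))"
    and distinct: "\<And>j. j < m + 3 \<Longrightarrow> x j \<noteq> c j \<and> x (Suc j) \<noteq> c j \<and> l j \<noteq> l (Suc j)"
    and on_passive: "\<And>j. j \<le> m + 3 \<Longrightarrow>
      x j = 0 \<and> 2 - N \<le> l j \<and> l j \<le> 0 \<or> \<bar>x j\<bar> = 1 \<and> 1 \<le> l j \<and> l j \<le> N + 2"
    and third_last: "c m = s * (N - 1)" "3 - N \<le> l m"
    and second_last: "x (Suc m) = 0" "c (Suc m) = - s * N" "l (Suc m) = 2 - N"
    and last: "x (m + 2) = - s" "l (m + 2) = N"
    and tuck: "x (m + 3) = s" "c (m + 3) = s * (N + 2)" "l (m + 3) = N + 1"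
  shows "no_cut_point (polyline (
    [Complex 0 (- N), Complex 0 1, Complex (-1) 1, Complex (-1) (N + 2), Complex 1 (N + 2), Complex 1 0]
    @ stair c l (m + 3) @
    [Complex (s * (N + 2)) (N + 1),
     Complex (s * (N + 2)) (8/3 - N), Complex (s * (N - 3/2)) (8/3 - N),
     Complex (s * (N - 3/2)) (7/3 - N), Complex (s * (N + 2)) (7/3 - N),
     Complex (s * (N + 2)) (- N), Complex 0 (- N)]))" (is "no_cut_point ?W")
proof -
  have N: "N \<ge> 3" by (simp add: N_def)
  let ?k = "m + 3" and ?ca = "s * (N - 1)" and ?cb = "s * (N - 3/2)" and ?cn = "s * (N + 2)"
  define neck where "neck =
    polyline [Complex 0 0, Complex 0 1, Complex (-1) 1, Complex (-1) (N + 2)] \<union>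
    polyline [Complex (-1) (N + 2), Complex 1 (N + 2), Complex 1 0, Complex 0 0]"
  \<comment> \<open>From the crossing of the last move back along the column of the move before it
    to the lowest crossing of the straight strand, then up to the first crossing.\<close>
  define ear where "ear = polyline [Complex (- s) N, Complex (- s * N) N, Complex (- s * N) (2 - N),
    Complex 0 (2 - N), Complex 0 0]"
  define arcs where "arcs = (\<Union>j<?k. stair_arc x c l j)"
  \<comment> \<open>The rest of the active strand is cut at \<open>t1\<close>, \<open>t2\<close> and
    \<open>t3\<close>: \<open>tail\<close> runs from \<open>t1\<close> to \<open>t2\<close>,
    \<open>hook\<close> from \<open>t2\<close> to \<open>t3\<close>, and \<open>exit\<close> from
    \<open>t3\<close> through the bottom point up to the lowest crossing of the straight
    strand.\<close>
  define tail where "tail =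
    polyline [Complex s (N + 1), Complex ?cn (N + 1), Complex ?cn (8/3 - N), Complex ?ca (8/3 - N)]"
  define hook where "hook =
    polyline [Complex ?ca (8/3 - N), Complex ?cb (8/3 - N), Complex ?cb (7/3 - N), Complex ?ca (7/3 - N)]"
  define exit where "exit =
    polyline [Complex ?ca (7/3 - N), Complex ?cn (7/3 - N), Complex ?cn (- N), Complex 0 (- N),
      Complex 0 (2 - N)]"
  note segs = axis_segments closed_segment_eq_real_ivl
  have "no_cut_point neck" unfolding neck_def using N by (intro no_cut_point_neck) auto
  then have "no_cut_point (neck \<union> ear)"
    unfolding ear_def using N s
    by (intro no_cut_point_HVHV) (auto simp: neck_def segs)
  moreover have "Complex (x j) (l j) \<in> neck \<union> ear" if "j \<le> ?k" for j
  proof -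
    \<comment> \<open>The three segments are the straight strand between its lowest and first
      crossings and the two sides of the neck loop.\<close>
    have "Complex (x j) (l j) \<in> closed_segment (Complex 0 (2 - N)) (Complex 0 0) \<or>
        Complex (x j) (l j) \<in> closed_segment (Complex 1 (N + 2)) (Complex 1 0) \<or>
        Complex (x j) (l j) \<in> closed_segment (Complex (-1) 1) (Complex (-1) (N + 2))"
      using on_passive[OF that] N unfolding segs by (auto simp: abs_if split: if_splits)
    then show ?thesis unfolding neck_def ear_def polyline.simps by blast
  qed
  ultimately have arcs: "no_cut_point (neck \<union> ear \<union> arcs)"
    unfolding arcs_def using distinct by (intro no_cut_point_Un_stair_arcs) auto
  \<comment> \<open>This part of the column of move \<open>m\<close> lies on the arc
    \<open>l\<close> of the tuck and contains \<open>t2\<close> and \<open>t3\<close>, at heights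
    \<open>8/3 - N\<close> and \<open>7/3 - N\<close>.\<close>
  have col: "Complex ?ca y \<in> arcs" if "2 - N \<le> y" "y \<le> 3 - N" for y
  proof -
    have "Complex ?ca y \<in> stair_arc x c l m"
      using that third_last second_last by (simp add: stair_arc_def segs)
    then show ?thesis unfolding arcs_def by force
  qed
  have "Complex s (N + 1) \<in> stair_arc x c l (m + 2)"
    using tuck by (simp add: stair_arc_def numeral_3_eq_3)
  then have tuck_arcs: "Complex s (N + 1) \<in> arcs" unfolding arcs_def by force
  have "no_cut_point (neck \<union> ear \<union> arcs \<union> tail)"
    unfolding tail_def using arcs tuck_arcs col N s by (intro no_cut_point_HVH) auto
  then have "no_cut_point (neck \<union> ear \<union> arcs \<union> tail \<union> hook)"
    unfolding hook_def using col N s by (intro no_cut_point_HVH) auto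
  then have "no_cut_point (neck \<union> ear \<union> arcs \<union> tail \<union> hook \<union> exit)"
    unfolding exit_def using col N s
    by (intro no_cut_point_HVHV) (auto simp: ear_def segs)
  moreover have "?W = neck \<union> ear \<union> arcs \<union> tail \<union> hook \<union> exit"
  proof -
    let ?pre = "[Complex 0 (- N), Complex 0 1, Complex (-1) 1, Complex (-1) (N + 2), Complex 1 (N + 2)]"
    let ?post = "[Complex ?cn (8/3 - N), Complex ?cb (8/3 - N), Complex ?cb (7/3 - N),
      Complex ?cn (7/3 - N), Complex ?cn (- N), Complex 0 (- N)]"
    obtain ys where ys: "stair c l ?k = Complex (c 0) 0 # ys"
      using first by (simp add: stair_def numeral_3_eq_3 upt_rec)
    \<comment> \<open>The first active edge is cut at the origin: its right part closes the neck,
      its left part begins the first stair arc.\<close>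
    have first_split: "closed_segment (Complex 1 0) (Complex (c 0) 0) =
        closed_segment (Complex 1 0) (Complex 0 0) \<union> closed_segment (Complex 0 0) (Complex (c 0) 0)"
      using first by (intro Un_closed_segment[symmetric]) (simp add: segs)
    have "Complex s (N + 1) \<in> closed_segment (Complex (c (m + 2)) (N + 1)) (Complex ?cn (N + 1))"
      using between[of "m + 2"] tuck by (simp add: horizontal_segment numeral_3_eq_3)
    from polyline_insert[OF this, of "stair c l (m + 2) @ [Complex (c (m + 2)) (l (m + 2))]" ?post]
    have insert: "polyline (stair c l ?k @ Complex ?cn (N + 1) # ?post) =
        polyline (stair c l ?k @ Complex s (N + 1) # Complex ?cn (N + 1) # ?post)"
      using tuck by (simp add: stair_Suc numeral_3_eq_3)
    have "?W = polyline ?pre \<union> closed_segment (Complex 1 (N + 2)) (Complex 1 0)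
        \<union> closed_segment (Complex 1 0) (Complex (c 0) 0)
        \<union> polyline (stair c l ?k @ Complex ?cn (N + 1) # ?post)"
      by (auto simp: ys)
    also have "\<dots> = polyline ?pre \<union> closed_segment (Complex 1 (N + 2)) (Complex 1 0)
        \<union> closed_segment (Complex 1 0) (Complex 0 0)
        \<union> polyline (Complex (x 0) (l 0) # stair c l ?k @ [Complex (x ?k) (l ?k)])
        \<union> polyline (Complex s (N + 1) # Complex ?cn (N + 1) # ?post)"
      unfolding first_split insert
      by (subst polyline_append_Cons[of "stair c l ?k"]) (simp add: ys first tuck Un_ac)
    also have "\<dots> = polyline ?pre \<union> closed_segment (Complex 1 (N + 2)) (Complex 1 0)
        \<union> closed_segment (Complex 1 0) (Complex 0 0) \<union> arcs
        \<union> polyline (Complex s (N + 1) # Complex ?cn (N + 1) # ?post)"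
      using first by (subst polyline_stair) (auto simp: arcs_def between)
    finally have W: "?W = \<dots>" .
    \<comment> \<open>From bottom to top, the three pieces of the straight strand belong to
      \<open>exit\<close>, \<open>ear\<close> and \<open>neck\<close>.\<close>
    have split_bottom: "closed_segment (Complex 0 (- N)) (Complex 0 1) =
        closed_segment (Complex 0 (- N)) (Complex 0 (2 - N)) \<union>
        (closed_segment (Complex 0 (2 - N)) (Complex 0 0) \<union> closed_segment (Complex 0 0) (Complex 0 1))"
      using N by (auto simp: segs)
    have split_hook: "closed_segment (Complex ?cn y) (Complex ?cb y) =
        closed_segment (Complex ?cn y) (Complex ?ca y) \<union> closed_segment (Complex ?ca y) (Complex ?cb y)" for y
      using s by (intro Un_closed_segment[symmetric]) (auto simp: segs)
    then have split_hook': "closed_segment (Complex ?cb y) (Complex ?cn y) =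
        closed_segment (Complex ?cb y) (Complex ?ca y) \<union> closed_segment (Complex ?ca y) (Complex ?cn y)" for y
      by (simp add: closed_segment_commute Un_commute)
    \<comment> \<open>All of \<open>ear\<close> but its piece of the straight strand is the stair
      arc number \<open>Suc m\<close>, traversed backwards, and so is contained in
      \<open>arcs\<close> as well.\<close>
    have ear: "ear = stair_arc x c l (Suc m) \<union> closed_segment (Complex 0 (2 - N)) (Complex 0 0)"
      using last second_last by (auto simp: ear_def stair_arc_def closed_segment_commute)
    have "stair_arc x c l (Suc m) \<subseteq> arcs" unfolding arcs_def by force
    then show ?thesis
      unfolding W ear neck_def tail_def hook_def exit_def polyline.simps split_bottom split_hook split_hook'
      by (auto simp: closed_segment_commute)
  qed
  ultimately show ?thesis by simp
qed

text \<open>The shape of the curve is determined by the sequence \<open>R\<close> of regions, in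
  which \<open>R (m + 3)\<close> is the region entered at the first tuck crossing.\<close>

lemma no_cut_point_tie_curve:
  fixes R :: "nat \<Rightarrow> region" and m :: nat
  defines "N \<equiv> real (m + 3)" and "s \<equiv> side (R m)"
    and "c \<equiv> \<lambda>j. side (R j) * (real j + 2)"
    and "l \<equiv> \<lambda>j. if j > 0 \<and> (R (j - 1) = Ctr \<or> R j = Ctr) then real j + 1 else - real j"
  assumes R0: "R 0 = Lft"
    and alt: "\<And>j. j < m + 3 \<Longrightarrow> R j \<noteq> R (Suc j)"
    and R: "R m \<noteq> Ctr" "R (Suc m) \<noteq> Ctr" "R (m + 2) = Ctr" "R (m + 3) = R m"
  shows "no_cut_point (polyline (
    [Complex 0 (- N), Complex 0 1, Complex (-1) 1, Complex (-1) (N + 2), Complex 1 (N + 2), Complex 1 0]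
    @ stair c l (m + 3) @
    [Complex (s * (N + 2)) (N + 1),
     Complex (s * (N + 2)) (8/3 - N), Complex (s * (N - 3/2)) (8/3 - N),
     Complex (s * (N - 3/2)) (7/3 - N), Complex (s * (N + 2)) (7/3 - N),
     Complex (s * (N + 2)) (- N), Complex 0 (- N)]))"
proof -
  \<comment> \<open>For two different regions the sum of their sides is the first coordinate of the
    line separating them: 0 between left and right, -1 or 1 if one is the center.\<close>
  define x where "x = (\<lambda>j. if j = 0 then 0 else side (R (j - 1)) + side (R j))"
  have opposite: "side (R (Suc m)) = - s"
    using alt[of m] R unfolding s_def by (cases "R m"; cases "R (Suc m)") auto
  have s: "s = 1 \<or> s = -1" using R unfolding s_def by (cases "R m") auto
  show ?thesis
    unfolding N_def
  proof (rule no_cut_point_tucked_curve[where x = x])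
    fix j assume j: "j < m + 3"
    show "x (Suc j) \<in> closed_segment (c j) (c (Suc j))"
      using alt[OF j] unfolding x_def c_def
      by (cases "R j"; cases "R (Suc j)") (auto simp: closed_segment_eq_real_ivl)
    have "x j \<noteq> c j"
    proof (cases j)
      case (Suc i)
      then show ?thesis
        using alt[of i] j unfolding x_def c_def by (cases "R i"; cases "R (Suc i)") auto
    qed (simp add: x_def c_def R0)
    moreover have "x (Suc j) \<noteq> c j"
      using alt[OF j] unfolding x_def c_def by (cases "R j"; cases "R (Suc j)") auto
    moreover have "l j \<noteq> l (Suc j)" unfolding l_def by auto
    ultimately show "x j \<noteq> c j \<and> x (Suc j) \<noteq> c j \<and> l j \<noteq> l (Suc j)" by blast
  next
    fix j assume j: "j \<le> m + 3"
    show "x j = 0 \<and> 2 - real (m + 3) \<le> l j \<and> l j \<le> 0 \<or>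
      \<bar>x j\<bar> = 1 \<and> 1 \<le> l j \<and> l j \<le> real (m + 3) + 2"
    proof (cases j)
      case (Suc i)
      show ?thesis
      proof (cases "R i = Ctr \<or> R j = Ctr")
        case True
        then show ?thesis
          using alt[of i] j Suc unfolding x_def l_def by (cases "R i"; cases "R (Suc i)") auto
      next
        case False
        \<comment> \<open>Both of these moves enter or leave the center. Hence
          \<open>j \<le> m + 1\<close>, which is the bound \<open>2 - N \<le> - j\<close> for
          crossings of the straight strand.\<close>
        then have "j \<noteq> m + 2" "j \<noteq> m + 3" using R Suc by auto
        then show ?thesis
          using False alt[of i] j Suc unfolding x_def l_def by (cases "R i"; cases "R (Suc i)") auto
      qed
    qed (simp add: x_def l_def)
  qed (use R R0 s opposite in \<open>auto simp: x_def c_def l_def s_def numeral_3_eq_3 algebra_simps\<close>)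
qed


section \<open>Tie diagrams of tucked lists\<close>

lemma plane_proj_pt [simp]: "plane_proj (pt a b h) = Complex a b"
  by (simp add: plane_proj_def)

lemma linear_plane_proj: "linear plane_proj"
  by (rule linearI) (auto simp: plane_proj_def complex_eq_iff)

lemma path_image_curve_tie_diagram:
  assumes "w \<noteq> Untucked []" "tie_polygon w \<noteq> []"
  shows "path_image (curve (tie_diagram w)) = polyline (map plane_proj (tie_polygon w))"
  using assms
  by (simp add: tie_diagram_def diagram_of_def path_image_compose path_image_polygonal_path
      linear_image_polyline[OF linear_plane_proj])

text \<open>\<open>active_strand\<close> groups the vertices by horizontal edges and
  \<open>stair\<close> by columns; this shift leaves the last vertex over.\<close>

lemma plane_proj_active_strand:
  assumes "length ms = Suc k"
  shows "map plane_proj (active_strand ms) =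
    stair (column ms) (level ms) k @ [Complex (column ms k) (level ms k)]"
proof -
  let ?c = "column ms" and ?l = "level ms"
  have "Complex (?c 0) (?l 0) #
      concat (map (\<lambda>j. [Complex (?c (j - 1)) (?l j), Complex (?c j) (?l j)]) [1..<Suc k]) =
      stair ?c ?l k @ [Complex (?c k) (?l k)]" for k
    by (induction k) (simp_all add: stair_Suc)
  then show ?thesis using assms by (simp add: active_strand_def map_concat o_def)
qed

lemma reduced_diagram_tucked:
  assumes "tie_sequence (Tucked ms)"
  shows "reduced_diagram (tie_diagram (Tucked ms))"
proof (rule reduced_diagram_if_no_cut_point)
  from assms obtain xs r r' d d' d'' where
    ms: "ms = xs @ [(r, d), (r', d'), (Ctr, d'')]" and rs: "(r, r') \<in> {(Lft, Rgt), (Rgt, Lft)}"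
    by (auto simp: suffix_def)
  define m where "m = length xs"
  \<comment> \<open>The first tuck crossing is appended as an in-move to \<open>r\<close>, as in
    \<open>tie_polygon\<close>.\<close>
  define ms' where "ms' = ms @ [(r, In)]"
  have len: "length ms = m + 3" "length ms' = Suc (m + 3)" by (simp_all add: ms ms'_def m_def)
  have r: "fst (ms ! m) = r" by (simp add: ms m_def nth_append)
  define R where "R = (\<lambda>j. fst (ms' ! j))"
  have alt: "successively (\<lambda>a b. fst a \<noteq> fst b) ms'"
  proof -
    have "successively (\<lambda>a b. fst a \<noteq> fst b) ms"
      using assms by (auto simp: alternating_def elim!: successively_mono)
    then show ?thesis
      using rs by (auto simp: ms'_def ms successively_append_iff)
  qed
  have R_hd: "R 0 = Lft" using assms by (cases ms) (auto simp: R_def ms'_def)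
  have R_alt: "R j \<noteq> R (Suc j)" if "j < m + 3" for j
    using successively_nth[OF alt, of j] that len by (simp add: R_def)
  have Rm: "R m = r" "R (Suc m) = r'" "R (m + 2) = Ctr" "R (m + 3) = r"
    by (simp_all add: R_def ms'_def ms m_def nth_append)
  have columns: "column ms' = (\<lambda>j. side (R j) * (real j + 2))"
    by (simp add: R_def column_def fun_eq_iff)
  have levels: "level ms' = (\<lambda>j. if j > 0 \<and> (R (j - 1) = Ctr \<or> R j = Ctr)
      then real j + 1 else - real j)"
    by (simp add: R_def level_def fun_eq_iff)
  have "no_cut_point (polyline (
    [Complex 0 (- real (m + 3)), Complex 0 1, Complex (-1) 1, Complex (-1) (real (m + 3) + 2),
     Complex 1 (real (m + 3) + 2), Complex 1 0]
    @ stair (column ms') (level ms') (m + 3) @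
    [Complex (side r * (real (m + 3) + 2)) (real (m + 3) + 1),
     Complex (side r * (real (m + 3) + 2)) (8/3 - real (m + 3)),
     Complex (side r * (real (m + 3) - 3/2)) (8/3 - real (m + 3)),
     Complex (side r * (real (m + 3) - 3/2)) (7/3 - real (m + 3)),
     Complex (side r * (real (m + 3) + 2)) (7/3 - real (m + 3)),
     Complex (side r * (real (m + 3) + 2)) (- real (m + 3)), Complex 0 (- real (m + 3))]))"
    unfolding columns levels Rm(1)[symmetric]
    by (rule no_cut_point_tie_curve) (use R_hd R_alt Rm rs in auto)
  moreover have "column ms' (m + 3) = side r * (real (m + 3) + 2)"
    "level ms' (m + 3) = real (m + 3) + 1"
    by (simp_all add: column_def level_def ms'_def ms m_def nth_append)
  ultimately show "no_cut_point (path_image (curve (tie_diagram (Tucked ms))))"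
    by (subst path_image_curve_tie_diagram)
      (simp_all add: Let_def r passive_strand_def plane_proj_active_strand[OF len(2)] len flip: ms'_def)
qed

theorem proposition17:
  fixes K :: "(real^3) set"
  assumes "tie_knot K"
  shows "\<exists>w. has_tie_diagram K w \<and> reduced_diagram (tie_diagram w)"
proof -
  from assms obtain w where w: "tie_sequence w" "represents (tie_diagram w) K"
    unfolding tie_knot_def by blast
  then have "reduced_diagram (tie_diagram w)"
    using reduced_diagram_tucked by (cases w) auto
  then show ?thesis using w unfolding has_tie_diagram_def by blast
qed

end
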